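(* Let $(L,A,\cdot,\ell)$ be a left-symmetric Rinehart algebra over a field $\mathbb K$ of characteristic zero, $(M;\rho,\mu)$ a representation of it, and $T_1,T_2:M\to L$ two $\mathcal O$-operators on $(L,A,\cdot,\ell)$ associated to $(M;\rho,\mu)$. Suppose that $T_1$ and $T_2$ are invertible. Then $T_1$ and $T_2$ are compatible if and only if $N=T_1\circ T_2^{-1}$ is a Nijenhuis operator on $(L,A,\cdot,\ell)$.
   Context: All vector spaces are over a field $\mathbb K$ of characteristic zero. A left-symmetric Rinehart algebra is a quadruple $(L,A,\cdot,\ell)$ where $A$ is an associative commutative $\mathbb K$-algebra, $L$ is an $A$-module with a bilinear product satisfying $(x\cdot y)\cdot z-x\cdot(y\cdot z)=(y\cdot x)\cdot z-y\cdot(x\cdot z)$, and $\ell:L\to \mathrm{Der}(A)$ is a linear map such that $\ell(x\cdot y-y\cdot x)=\ell(x)\ell(y)-\ell(y)\ell(x)$, $\ell(ax)=a\ell(x)$, $x\cdot(ay)=\ell(x)(a)\,y+a(x\cdot y)$, and $(ax)\cdot y=a(x\cdot y)$ for all $a\in A$, $x,y,z\in L$. Write $[x,y]=x\cdot y-y\cdot x$. A representation $(M;\rho,\mu)$ of $(L,A,\cdot,\ell)$ consists of an $A$-module $M$, a linear map $\rho:L\to\mathrm{End}_{\mathbb K}(M)$ with $\rho([x,y])=\rho(x)\rho(y)-\rho(y)\rho(x)$, $\rho(ax)m=a\rho(x)m$, $\rho(x)(am)=a\rho(x)m+\ell(x)(a)m$, and a linear map $\mu:L\to \mathrm{End}_{\mathbb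 K}(M)$ with $\mu(ax)m=a\mu(x)m=\mu(x)(am)$ and $\rho(x)\mu(y)-\mu(y)\rho(x)=\mu(x\cdot y)-\mu(y)\mu(x)$. An $\mathcal O$-operator associated to $(M;\rho,\mu)$ is a linear map $T:M\to L$ with $T(au)=aT(u)$ and $T(u)\cdot T(v)=T(\rho(T(u))(v)+\mu(T(v))(u))$ for all $u,v\in M$, $a\in A$. Two $\mathcal O$-operators $T_1,T_2$ associated to $(M;\rho,\mu)$ are compatible if $T_1+T_2$ is an $\mathcal O$-operator associated to $(M;\rho,\mu)$. A Nijenhuis operator on $(L,A,\cdot,\ell)$ is an $A$-linear map $N:L\to L$ with $N(x)\cdot N(y)-N(x\cdot N(y))-N(N(x)\cdot y)+N^2(x\cdot y)=0$ for all $x,y\in L$. *)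

theory Defs
  imports Complex_Main
begin

text \<open>
  Each carrier is a whole type: \<open>'k\<close> is the ground field, \<open>'a\<close> the algebra \<open>A\<close>, \<open>'l\<close> the module
  \<open>L\<close> and \<open>'m\<close> the representation space \<open>M\<close>.  The \<open>\<bbbK>\<close>-vector space structures are given by scalar
  multiplications \<open>sA\<close>, \<open>sL\<close>, \<open>sM\<close>, and the \<open>A\<close>-module structures by actions \<open>aL\<close>, \<open>aM\<close>.

  Neither a unit in \<open>A\<close> nor unitality of the actions is assumed, so unital algebras
  with unital modules are a special case.  Without a unit the \<open>\<bbbK>\<close>-structure of a module is not
  determined by that of \<open>A\<close>; it is therefore part of the data and \<open>\<bbbK>\<close>-linearity is always required
  next to \<open>A\<close>-linearity.
\<close>

locale comm_assoc_algebra = vector_space sA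
  for sA :: "'k::field_char_0 \<Rightarrow> 'a::comm_ring \<Rightarrow> 'a" +
  assumes scale_mult: "sA k (a * b) = sA k a * b"

locale algebra_module = A: comm_assoc_algebra sA + V: vector_space sV
  for sA :: "'k::field_char_0 \<Rightarrow> 'a::comm_ring \<Rightarrow> 'a"
    and sV :: "'k \<Rightarrow> 'v::ab_group_add \<Rightarrow> 'v"
    and act :: "'a \<Rightarrow> 'v \<Rightarrow> 'v" +
  assumes act_linear_left: "Vector_Spaces.linear sA sV (\<lambda>a. act a v)"
    and act_linear_right: "Vector_Spaces.linear sV sV (act a)"
    and act_mult: "act (a * b) v = act a (act b v)"

definition Der :: "('k::field_char_0 \<Rightarrow> 'a::comm_ring \<Rightarrow> 'a) \<Rightarrow> ('a \<Rightarrow> 'a) set" where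
  "Der sA = {D. Vector_Spaces.linear sA sA D \<and> (\<forall>a b. D (a * b) = D a * b + a * D b)}"

text \<open>
  Linearity of a map into a space of endomorphisms (here \<open>ell\<close>, and below \<open>\<rho>\<close> and \<open>\<mu>\<close>) refers to
  the pointwise vector space structure of that space, hence is stated after evaluation at a point.
\<close>

locale left_symmetric_rinehart_algebra = algebra_module sA sL aL
  for sA :: "'k::field_char_0 \<Rightarrow> 'a::comm_ring \<Rightarrow> 'a"
    and sL :: "'k \<Rightarrow> 'l::ab_group_add \<Rightarrow> 'l"
    and aL :: "'a \<Rightarrow> 'l \<Rightarrow> 'l"
    and pr :: "'l \<Rightarrow> 'l \<Rightarrow> 'l"
    and ell :: "'l \<Rightarrow> 'a \<Rightarrow> 'a" +
  assumes pr_linear_left: "Vector_Spaces.linear sL sL (\<lambda>x. pr x y)"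
    and pr_linear_right: "Vector_Spaces.linear sL sL (pr x)"
    and left_symmetric:
      "pr (pr x y) z - pr x (pr y z) = pr (pr y x) z - pr y (pr x z)"
    and ell_Der: "ell x \<in> Der sA"
    and ell_linear: "Vector_Spaces.linear sL sA (\<lambda>x. ell x a)"
    and ell_commutator: "ell (pr x y - pr y x) a = ell x (ell y a) - ell y (ell x a)"
    and ell_act: "ell (aL a x) b = a * ell x b"
    and pr_act_right: "pr x (aL a y) = aL (ell x a) y + aL a (pr x y)"
    and pr_act_left: "pr (aL a x) y = aL a (pr x y)"

locale rinehart_representation =
  left_symmetric_rinehart_algebra sA sL aL pr ell + M: algebra_module sA sM aM
  for sA :: "'k::field_char_0 \<Rightarrow> 'a::comm_ring \<Rightarrow> 'a"
    and sL :: "'k \<Rightarrow> 'l::ab_group_add \<Rightarrow> 'l"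
    and aL :: "'a \<Rightarrow> 'l \<Rightarrow> 'l"
    and pr :: "'l \<Rightarrow> 'l \<Rightarrow> 'l"
    and ell :: "'l \<Rightarrow> 'a \<Rightarrow> 'a"
    and sM :: "'k \<Rightarrow> 'm::ab_group_add \<Rightarrow> 'm"
    and aM :: "'a \<Rightarrow> 'm \<Rightarrow> 'm"
    and \<rho> :: "'l \<Rightarrow> 'm \<Rightarrow> 'm"
    and \<mu> :: "'l \<Rightarrow> 'm \<Rightarrow> 'm" +
  assumes rho_End: "Vector_Spaces.linear sM sM (\<rho> x)"
    and rho_linear: "Vector_Spaces.linear sL sM (\<lambda>x. \<rho> x m)"
    and rho_commutator: "\<rho> (pr x y - pr y x) m = \<rho> x (\<rho> y m) - \<rho> y (\<rho> x m)"
    and rho_act_left: "\<rho> (aL a x) m = aM a (\<rho> x m)"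
    and rho_act_right: "\<rho> x (aM a m) = aM a (\<rho> x m) + aM (ell x a) m"
    and mu_End: "Vector_Spaces.linear sM sM (\<mu> x)"
    and mu_linear: "Vector_Spaces.linear sL sM (\<lambda>x. \<mu> x m)"
    and mu_act_left: "\<mu> (aL a x) m = aM a (\<mu> x m)"
    and mu_act_right: "\<mu> x (aM a m) = aM a (\<mu> x m)"
    and rho_mu: "\<rho> x (\<mu> y m) - \<mu> y (\<rho> x m) = \<mu> (pr x y) m - \<mu> y (\<mu> x m)"

definition O_operator ::
  "('k::field_char_0 \<Rightarrow> 'l::ab_group_add \<Rightarrow> 'l) \<Rightarrow> ('a::comm_ring \<Rightarrow> 'l \<Rightarrow> 'l) \<Rightarrow> ('l \<Rightarrow> 'l \<Rightarrow> 'l) \<Rightarrow>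
   ('k \<Rightarrow> 'm::ab_group_add \<Rightarrow> 'm) \<Rightarrow> ('a \<Rightarrow> 'm \<Rightarrow> 'm) \<Rightarrow> ('l \<Rightarrow> 'm \<Rightarrow> 'm) \<Rightarrow> ('l \<Rightarrow> 'm \<Rightarrow> 'm) \<Rightarrow>
   ('m \<Rightarrow> 'l) \<Rightarrow> bool" where
  "O_operator sL aL pr sM aM \<rho> \<mu> T \<longleftrightarrow>
     Vector_Spaces.linear sM sL T \<and>
     (\<forall>a u. T (aM a u) = aL a (T u)) \<and>
     (\<forall>u v. pr (T u) (T v) = T (\<rho> (T u) v + \<mu> (T v) u))"

definition compatible_O_operators ::
  "('k::field_char_0 \<Rightarrow> 'l::ab_group_add \<Rightarrow> 'l) \<Rightarrow> ('a::comm_ring \<Rightarrow> 'l \<Rightarrow> 'l) \<Rightarrow> ('l \<Rightarrow> 'l \<Rightarrow> 'l) \<Rightarrow>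
   ('k \<Rightarrow> 'm::ab_group_add \<Rightarrow> 'm) \<Rightarrow> ('a \<Rightarrow> 'm \<Rightarrow> 'm) \<Rightarrow> ('l \<Rightarrow> 'm \<Rightarrow> 'm) \<Rightarrow> ('l \<Rightarrow> 'm \<Rightarrow> 'm) \<Rightarrow>
   ('m \<Rightarrow> 'l) \<Rightarrow> ('m \<Rightarrow> 'l) \<Rightarrow> bool" where
  "compatible_O_operators sL aL pr sM aM \<rho> \<mu> T1 T2 \<longleftrightarrow>
     O_operator sL aL pr sM aM \<rho> \<mu> T1 \<and>
     O_operator sL aL pr sM aM \<rho> \<mu> T2 \<and>
     O_operator sL aL pr sM aM \<rho> \<mu> (\<lambda>u. T1 u + T2 u)"

definition Nijenhuis_operator ::
  "('k::field_char_0 \<Rightarrow> 'l::ab_group_add \<Rightarrow> 'l) \<Rightarrow> ('a::comm_ring \<Rightarrow> 'l \<Rightarrow> 'l) \<Rightarrow> ('l \<Rightarrow> 'l \<Rightarrow> 'l) \<Rightarrow>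
   ('l \<Rightarrow> 'l) \<Rightarrow> bool" where
  "Nijenhuis_operator sL aL pr N \<longleftrightarrow>
     Vector_Spaces.linear sL sL N \<and>
     (\<forall>a x. N (aL a x) = aL a (N x)) \<and>
     (\<forall>x y. pr (N x) (N y) - N (pr x (N y)) - N (pr (N x) y) + N (N (pr x y)) = 0)"

end

(* Put x = T2 u, y = T2 v, and B_i(u, v) = \<rho>(T_i u) v + \<mu>(T_i v) u.  By bilinearity, T1 + T2 is
   an O-operator iff the mixed terms cancel, i.e. iff
     D(u, v) = T1 u . T2 v + T2 u . T1 v - T1 B_2(u, v) - T2 B_1(u, v)
   vanishes for all u, v.  For N = T1 T2^-1, the O-operator identities of T1 and T2 turn the
   Nijenhuis torsion of N at (x, y) into - N(D(u, v)), and N is injective. *)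

theory Submission
  imports Defs
begin

lemma linear_inv_bij:
  assumes "Vector_Spaces.linear s1 s2 f" and "bij f"
  shows "Vector_Spaces.linear s2 s1 (inv f)"
proof -
  have f_inv: "f (inv f y) = y" for y
    using assms(2) by (simp add: bij_is_surj surj_f_inv_f)
  show ?thesis
    \<comment> \<open>Each identity for \<open>inv f\<close> can be checked after applying the
      bijection \<open>f\<close>, where it becomes linearity of \<open>f\<close> itself.\<close>
    using assms(1) unfolding Vector_Spaces.linear_iff
    by (metis assms(2) bij_inv_eq_iff f_inv)
qed

lemma linear_add_fun:
  assumes "Vector_Spaces.linear s1 s2 f" and "Vector_Spaces.linear s1 s2 g"
  shows "Vector_Spaces.linear s1 s2 (\<lambda>x. f x + g x)"
  using assms unfolding Vector_Spaces.linear_iff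
  by (auto simp: algebra_simps vector_space.vector_space_assms(1))

context rinehart_representation
begin

text \<open>Linear and \<open>A\<close>-linear maps are closed under sums, so compatibility comes
  down to the product identity of \<open>T1 + T2\<close>. After expansion its pure terms cancel by
  the identities of \<open>T1\<close> and \<open>T2\<close> separately.\<close>

lemma compatible_O_operators_iff:
  assumes T1: "O_operator sL aL pr sM aM \<rho> \<mu> T1"
    and T2: "O_operator sL aL pr sM aM \<rho> \<mu> T2"
  shows "compatible_O_operators sL aL pr sM aM \<rho> \<mu> T1 T2 \<longleftrightarrow>
    (\<forall>u v. pr (T1 u) (T2 v) + pr (T2 u) (T1 v) =
       T1 (\<rho> (T2 u) v + \<mu> (T2 v) u) + T2 (\<rho> (T1 u) v + \<mu> (T1 v) u))"
proof -
  have lin: "Vector_Spaces.linear sM sL T1" "Vector_Spaces.linear sM sL T2"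
    and prod: "pr (T1 u) (T1 v) = T1 (\<rho> (T1 u) v + \<mu> (T1 v) u)"
      "pr (T2 u) (T2 v) = T2 (\<rho> (T2 u) v + \<mu> (T2 v) u)"
    and act: "T1 (aM a u) = aL a (T1 u)" "T2 (aM a u) = aL a (T2 u)" for a u v
    using T1 T2 by (auto simp: O_operator_def)
  have add: "T1 (m + n) = T1 m + T1 n" "T2 (m + n) = T2 m + T2 n"
    "\<rho> (x + y) m = \<rho> x m + \<rho> y m" "\<mu> (x + y) m = \<mu> x m + \<mu> y m"
    "pr (x + y) z = pr x z + pr y z" "pr x (y + z) = pr x y + pr x z"
    "aL a (x + y) = aL a x + aL a y" for m n x y z a
    using lin rho_linear mu_linear pr_linear_left pr_linear_right act_linear_right
    unfolding Vector_Spaces.linear_iff by auto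
  show ?thesis
    using T1 T2 linear_add_fun[OF lin]
    by (simp add: compatible_O_operators_def O_operator_def act add prod algebra_simps)
qed

text \<open>Every term of the torsion is a value of \<open>N\<close>: the first is \<open>T1\<close>
  of some \<open>m\<close>, hence \<open>N (T2 m)\<close>, and the last is
  \<open>N (N (T2 n)) = N (T1 n)\<close>. Only linearity of \<open>N\<close> and
  \<open>N (T2 u) = T1 u\<close> are used about \<open>N\<close>, so no inverse appears.\<close>

lemma Nijenhuis_torsion_eq:
  assumes T1: "O_operator sL aL pr sM aM \<rho> \<mu> T1"
    and T2: "O_operator sL aL pr sM aM \<rho> \<mu> T2"
    and N: "Vector_Spaces.linear sL sL N" and NT2: "\<And>u. N (T2 u) = T1 u"
  shows "pr (N (T2 u)) (N (T2 v)) - N (pr (T2 u) (N (T2 v))) - N (pr (N (T2 u)) (T2 v))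
      + N (N (pr (T2 u) (T2 v))) =
    N (T1 (\<rho> (T2 u) v + \<mu> (T2 v) u) + T2 (\<rho> (T1 u) v + \<mu> (T1 v) u)
      - (pr (T1 u) (T2 v) + pr (T2 u) (T1 v)))"
proof -
  have prod: "pr (T1 u) (T1 v) = T1 (\<rho> (T1 u) v + \<mu> (T1 v) u)"
      "pr (T2 u) (T2 v) = T2 (\<rho> (T2 u) v + \<mu> (T2 v) u)"
    using T1 T2 by (auto simp: O_operator_def)
  interpret N: Vector_Spaces.linear sL sL N by (fact N)
  show ?thesis
    by (simp only: NT2 prod N.add N.diff) simp
qed

end

theorem corollary7p11:
  fixes sA :: "'k::field_char_0 \<Rightarrow> 'a::comm_ring \<Rightarrow> 'a"
    and sL :: "'k \<Rightarrow> 'l::ab_group_add \<Rightarrow> 'l"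
    and aL :: "'a \<Rightarrow> 'l \<Rightarrow> 'l"
    and pr :: "'l \<Rightarrow> 'l \<Rightarrow> 'l"
    and ell :: "'l \<Rightarrow> 'a \<Rightarrow> 'a"
    and sM :: "'k \<Rightarrow> 'm::ab_group_add \<Rightarrow> 'm"
    and aM :: "'a \<Rightarrow> 'm \<Rightarrow> 'm"
    and \<rho> :: "'l \<Rightarrow> 'm \<Rightarrow> 'm"
    and \<mu> :: "'l \<Rightarrow> 'm \<Rightarrow> 'm"
    and T1 :: "'m \<Rightarrow> 'l"
    and T2 :: "'m \<Rightarrow> 'l"
  assumes "left_symmetric_rinehart_algebra sA sL aL pr ell"
    and "rinehart_representation sA sL aL pr ell sM aM \<rho> \<mu>"
    and "O_operator sL aL pr sM aM \<rho> \<mu> T1"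
    and "O_operator sL aL pr sM aM \<rho> \<mu> T2"
    and "bij T1"
    and "bij T2"
  shows "compatible_O_operators sL aL pr sM aM \<rho> \<mu> T1 T2 \<longleftrightarrow>
         Nijenhuis_operator sL aL pr (T1 \<circ> inv T2)"
proof -
  interpret rinehart_representation sA sL aL pr ell sM aM \<rho> \<mu> by fact
  note T1 = assms(3) and T2 = assms(4)
  define N where "N = T1 \<circ> inv T2"
  have NT2: "N (T2 u) = T1 u" for u
    using \<open>bij T2\<close> by (simp add: N_def bij_is_inj)
  have "bij N"
    unfolding N_def using \<open>bij T1\<close> \<open>bij T2\<close> by (intro bij_comp bij_imp_bij_inv)
  have surj: "\<exists>u. x = T2 u" for x
    using \<open>bij T2\<close> by (metis bij_pointE)
  have lin: "Vector_Spaces.linear sL sL N"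
    unfolding N_def using T1 T2 \<open>bij T2\<close>
    by (intro Vector_Spaces.linear_compose linear_inv_bij) (auto simp: O_operator_def)
  have N_act: "N (aL a x) = aL a (N x)" for a x
    \<comment> \<open>With \<open>x = T2 u\<close>, both sides equal
      \<open>T1 (aM a u)\<close>.\<close>
    using surj[of x] T1 T2 NT2 unfolding O_operator_def by metis
  interpret N: Vector_Spaces.linear sL sL N by (fact lin)
  \<comment> \<open>Invertibility of \<open>T1\<close> enters here, through \<open>bij N\<close>:
    the outer \<open>N\<close> in the torsion formula can be stripped.\<close>
  have N_eq_0: "N x = 0 \<longleftrightarrow> x = 0" for x
    using \<open>bij N\<close> N.zero by (metis bij_is_inj injD)
  have "Nijenhuis_operator sL aL pr N \<longleftrightarrow>
      (\<forall>u v. pr (N (T2 u)) (N (T2 v)) - N (pr (T2 u) (N (T2 v))) - N (pr (N (T2 u)) (T2 v))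
        + N (N (pr (T2 u) (T2 v))) = 0)"
    \<comment> \<open>Surjectivity of \<open>T2\<close> lets \<open>T2 u\<close>,
      \<open>T2 v\<close> stand for arbitrary elements of \<open>L\<close>.\<close>
    using lin N_act surj unfolding Nijenhuis_operator_def by metis
  also have "\<dots> \<longleftrightarrow> compatible_O_operators sL aL pr sM aM \<rho> \<mu> T1 T2"
    unfolding Nijenhuis_torsion_eq[OF T1 T2 lin NT2] N_eq_0 compatible_O_operators_iff[OF T1 T2]
    by (metis right_minus_eq)
  finally show ?thesis
    unfolding N_def by blast
qed

end
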